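(* Let $R$ be a commutative ring with unity and $Y\subseteq\mathrm{Spec}(R)$. (a) An ideal $I$ of $R$ is an $\mathcal{H}_Y$-ideal if and only if it is an intersection of prime ideals minimal over $I$ which are $\mathcal{H}_Y$-ideals. Likewise, $I$ is a strong $\mathcal{H}_Y$-ideal if and only if it is an intersection of prime ideals minimal over $I$ which are strong $\mathcal{H}_Y$-ideals. (b) Every ideal that is maximal among the proper $\mathcal{H}_Y$-ideals is a prime ideal (hence a prime $\mathcal{H}_Y$-ideal), and every ideal that is maximal among the proper strong $\mathcal{H}_Y$-ideals is a prime ideal (hence a prime strong $\mathcal{H}_Y$-ideal).
   Context: $h_Y(S)=\{P\in Y: S\subseteq P\}$ for $S\subseteq R$, and $h_Y(a)=h_Y(\{a\})$. An ideal $I$ of $R$ (not necessarily proper) is an $\mathcal{H}_Y$-ideal if $a\in I$, $b\in R$ and $h_Y(a)\subseteq h_Y(b)$ imply $b\in I$. It is a strong $\mathcal{H}_Y$-ideal if for every finite subset $F\subseteq I$ and every $b\in R$, $h_Y(F)\subseteq h_Y(b)$ implies $b\in I$. The intersection of the empty family of ideals is $R$. *)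

theory Defs
  imports "HOL-Algebra.Algebra"
begin

definition Spec :: "('a, 'm) ring_scheme \<Rightarrow> 'a set set"
  where "Spec R = {P. primeideal P R}"

definition h_sub :: "'a set set \<Rightarrow> 'a set \<Rightarrow> 'a set set"
  where "h_sub Y S = {P \<in> Y. S \<subseteq> P}"

text \<open>The ideals below need not be proper: the whole ring is always an instance of both notions.\<close>

definition H_ideal :: "('a, 'm) ring_scheme \<Rightarrow> 'a set set \<Rightarrow> 'a set \<Rightarrow> bool"
  where "H_ideal R Y I \<longleftrightarrow>
    ideal I R \<and> (\<forall>a \<in> I. \<forall>b \<in> carrier R. h_sub Y {a} \<subseteq> h_sub Y {b} \<longrightarrow> b \<in> I)"

definition strong_H_ideal :: "('a, 'm) ring_scheme \<Rightarrow> 'a set set \<Rightarrow> 'a set \<Rightarrow> bool"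
  where "strong_H_ideal R Y I \<longleftrightarrow>
    ideal I R \<and>
    (\<forall>F b. finite F \<and> F \<subseteq> I \<and> b \<in> carrier R \<and> h_sub Y F \<subseteq> h_sub Y {b} \<longrightarrow> b \<in> I)"

definition minimal_prime_over :: "('a, 'm) ring_scheme \<Rightarrow> 'a set \<Rightarrow> 'a set \<Rightarrow> bool"
  where "minimal_prime_over R I P \<longleftrightarrow>
    primeideal P R \<and> I \<subseteq> P \<and> (\<forall>Q. primeideal Q R \<and> I \<subseteq> Q \<and> Q \<subseteq> P \<longrightarrow> Q = P)"

text \<open>Intersecting with the carrier makes the intersection of the empty family the ring itself
  rather than the whole type.\<close>

definition ideal_Inter :: "('a, 'm) ring_scheme \<Rightarrow> 'a set set \<Rightarrow> 'a set"
  where "ideal_Inter R \<P> = carrier R \<inter> \<Inter>\<P>"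

definition maximal_among_proper :: "('a, 'm) ring_scheme \<Rightarrow> ('a set \<Rightarrow> bool) \<Rightarrow> 'a set \<Rightarrow> bool"
  where "maximal_among_proper R p M \<longleftrightarrow>
    p M \<and> M \<noteq> carrier R \<and> (\<forall>J. p J \<and> J \<noteq> carrier R \<and> M \<subseteq> J \<longrightarrow> J = M)"

end

theory Submission
  imports Defs
begin

text \<open>For an H-ideal I (of either kind) and x outside I, take a multiplicative set S
  containing x that is maximal among those disjoint from I. Since I is radical, every a outside S
  satisfies s a \<in> I for some s \<in> S. Hence the complement of S is a prime ideal
  minimal over I, and multiplying a finite subset of it by a common s moves that subset into I, which
  shows that the complement is itself an H-ideal. For the maximal elements, the colon ideal
  (M : a) of an H-ideal M is again an H-ideal, so it equals M whenever a is outside M.\<close>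

section \<open>Radical ideals, primes and multiplicative sets\<close>

definition (in cring) radical_ideal :: "'a set \<Rightarrow> bool"
  where "radical_ideal I \<longleftrightarrow>
    ideal I R \<and> (\<forall>a \<in> carrier R. \<forall>n::nat. a [^] n \<in> I \<longrightarrow> a \<in> I)"

lemma (in primeideal) prime_powD:
  assumes "a \<in> carrier R" "a [^] (n::nat) \<in> I"
  shows "a \<in> I"
  using assms(2)
proof (induction n)
  \<comment> \<open>The power is \<one> here, so \<open>I\<close> is the whole carrier and contains
    a.\<close>
  case 0
  then show ?case using one_imp_carrier assms(1) by simp
next
  case (Suc n)
  then show ?case using I_prime[of "a [^] n" a] assms(1) by auto
qed

lemma (in primeideal) submonoid_complement: "submonoid (carrier R - I) R"
proof
  show "\<one> \<in> carrier R - I" using one_imp_carrier I_notcarr by auto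
qed (use I_prime in auto)

text \<open>This is the multiplicative set generated by \<open>S\<close> and a. It gives the powers
  of x as a starting point for Zorn, and later the enlargement of a maximal set by one
  element.\<close>

lemma (in cring) submonoid_powers:
  assumes "submonoid S R" "a \<in> carrier R"
  shows "submonoid {s \<otimes> a [^] (n::nat) |s n. s \<in> S} R"
proof -
  interpret S: submonoid S R by fact
  show ?thesis
  proof
    show "{s \<otimes> a [^] (n::nat) |s n. s \<in> S} \<subseteq> carrier R"
      using assms(2) by auto
    have "\<one> = \<one> \<otimes> a [^] (0::nat)" by simp
    then show "\<one> \<in> {s \<otimes> a [^] (n::nat) |s n. s \<in> S}"
      using S.one_closed by blast
    fix x y
    assume "x \<in> {s \<otimes> a [^] (n::nat) |s n. s \<in> S}" "y \<in> {s \<otimes> a [^] (n::nat) |s n. s \<in> S}"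
    then obtain s t and m n :: nat
      where st: "s \<in> S" "t \<in> S" and xy: "x = s \<otimes> a [^] m" "y = t \<otimes> a [^] n"
      by blast
    have "x \<otimes> y = (s \<otimes> t) \<otimes> (a [^] m \<otimes> a [^] n)"
      using st assms(2) S.mem_carrier unfolding xy by (simp add: m_ac)
    also have "\<dots> = (s \<otimes> t) \<otimes> a [^] (m + n)"
      using assms(2) by (simp add: nat_pow_mult)
    finally show "x \<otimes> y \<in> {s \<otimes> a [^] (n::nat) |s n. s \<in> S}"
      using st S.m_closed by blast
  qed
qed

section \<open>Multiplicative sets maximal among those disjoint from an ideal\<close>

definition (in cring) maximal_avoiding :: "'a set \<Rightarrow> 'a set \<Rightarrow> bool"
  where "maximal_avoiding I S \<longleftrightarrow> submonoid S R \<and> S \<inter> I = {} \<and>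
    (\<forall>T. submonoid T R \<and> T \<inter> I = {} \<and> S \<subseteq> T \<longrightarrow> T = S)"

lemma (in cring) ex_maximal_avoiding:
  assumes "radical_ideal I" "x \<in> carrier R" "x \<notin> I"
  obtains S where "maximal_avoiding I S" "x \<in> S"
proof -
  let ?A = "{S. submonoid S R \<and> S \<inter> I = {} \<and> x \<in> S}"
  \<comment> \<open>The powers of x, written so that \<open>submonoid_powers\<close> applies to
    {\<one>}. Radicality keeps them off \<open>I\<close>, because x is outside
    \<open>I\<close>.\<close>
  let ?P = "{s \<otimes> x [^] (n::nat) |s n. s \<in> {\<one>}}"
  have "submonoid {\<one>} R" by unfold_locales auto
  then have "submonoid ?P R" using submonoid_powers assms(2) by blast
  moreover have "?P \<inter> I = {}"
    using assms unfolding radical_ideal_def by auto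
  moreover have "x = \<one> \<otimes> x [^] (1::nat)" using assms(2) by simp
  then have "x \<in> ?P" by blast
  ultimately have "?A \<noteq> {}" by blast
  moreover have "\<Union>\<C> \<in> ?A" if "\<C> \<noteq> {}" and chain: "subset.chain ?A \<C>" for \<C>
  proof -
    have sub: "\<C> \<subseteq> ?A" and lin: "\<And>S T. S \<in> \<C> \<Longrightarrow> T \<in> \<C> \<Longrightarrow> S \<subseteq> T \<or> T \<subseteq> S"
      using chain unfolding subset_chain_def by auto
    have "submonoid (\<Union>\<C>) R"
    proof
      show "\<Union>\<C> \<subseteq> carrier R" using sub submonoid.subset by blast
      show "\<one> \<in> \<Union>\<C>" using sub \<open>\<C> \<noteq> {}\<close> submonoid.one_closed by blast
      fix y z assume "y \<in> \<Union>\<C>" "z \<in> \<Union>\<C>"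
      \<comment> \<open>Members of the chain containing y and z are comparable, so the larger one
        contains both.\<close>
      then obtain S where "S \<in> \<C>" "y \<in> S" "z \<in> S" using lin by blast
      moreover then have "submonoid S R" using sub by blast
      ultimately have "y \<otimes> z \<in> S" using submonoid.m_closed by metis
      then show "y \<otimes> z \<in> \<Union>\<C>" using \<open>S \<in> \<C>\<close> by blast
    qed
    then show ?thesis using sub \<open>\<C> \<noteq> {}\<close> by blast
  qed
  ultimately obtain S where S: "S \<in> ?A" "\<forall>T \<in> ?A. S \<subseteq> T \<longrightarrow> T = S"
    using subset_Zorn_nonempty[of ?A] by blast
  then have "maximal_avoiding I S" "x \<in> S"
    unfolding maximal_avoiding_def by auto
  then show thesis by (rule that)
qed

text \<open>Adjoining a to \<open>S\<close> gives a strictly larger multiplicative set, which must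
  meet \<open>I\<close> by maximality. So s a^n lies in \<open>I\<close> for some s and n, and
  radicality removes the exponent.\<close>

lemma (in cring) maximal_avoiding_mult:
  assumes rad: "radical_ideal I" and max: "maximal_avoiding I S"
    and a: "a \<in> carrier R" "a \<notin> S"
  obtains s where "s \<in> S" "s \<otimes> a \<in> I"
proof -
  interpret I: ideal I R using rad unfolding radical_ideal_def by simp
  interpret S: submonoid S R using max unfolding maximal_avoiding_def by simp
  let ?T = "{s \<otimes> a [^] (n::nat) |s n. s \<in> S}"
  have "s \<in> ?T" if "s \<in> S" for s
  proof -
    have "s = s \<otimes> a [^] (0::nat)" using that S.mem_carrier by simp
    then show ?thesis using that by blast
  qed
  then have "S \<subseteq> ?T" by blast
  have "a = \<one> \<otimes> a [^] (1::nat)" using a by simp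
  then have "a \<in> ?T" using S.one_closed by blast
  then have "?T \<noteq> S" using a by blast
  moreover have "submonoid ?T R" using submonoid_powers S.submonoid_axioms a by blast
  ultimately have "?T \<inter> I \<noteq> {}"
    using max \<open>S \<subseteq> ?T\<close> unfolding maximal_avoiding_def by blast
  then obtain s and n :: nat where s: "s \<in> S" and sa: "s \<otimes> a [^] n \<in> I" by blast
  have sc: "s \<in> carrier R" using s S.mem_carrier by simp
  \<comment> \<open>With the exponent n + 1 the cofactor of s a^n is s^n a, which makes sense for n
    = 0 too.\<close>
  have "(s \<otimes> a) [^] Suc n = (s [^] n \<otimes> a) \<otimes> (s \<otimes> a [^] n)"
    using sc a by (simp add: nat_pow_distrib m_ac)
  also have "\<dots> \<in> I" using sa sc a by (simp add: I.I_l_closed)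
  finally have "s \<otimes> a \<in> I"
    using rad sc a m_closed unfolding radical_ideal_def by blast
  then show thesis using s that by blast
qed

text \<open>The product of the multipliers of the single elements serves for all of them, since
  \<open>I\<close> absorbs the extra factors.\<close>

lemma (in cring) maximal_avoiding_mult_finite:
  assumes rad: "radical_ideal I" and max: "maximal_avoiding I S"
    and "finite F" "F \<subseteq> carrier R - S"
  obtains s where "s \<in> S" "(\<otimes>) s ` F \<subseteq> I"
proof -
  interpret I: ideal I R using rad unfolding radical_ideal_def by simp
  interpret S: submonoid S R using max unfolding maximal_avoiding_def by simp
  have "\<exists>s \<in> S. (\<otimes>) s ` F \<subseteq> I"
    using assms(3,4)
  proof (induction F)
    case empty
    then show ?case using S.one_closed by blast
  next
    case (insert a F)
    then obtain s where s: "s \<in> S" "(\<otimes>) s ` F \<subseteq> I" by auto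
    obtain t where t: "t \<in> S" "t \<otimes> a \<in> I"
      using maximal_avoiding_mult[OF rad max, of a] insert.prems by blast
    have sc: "s \<in> carrier R" "t \<in> carrier R" "a \<in> carrier R"
      using s t S.mem_carrier insert.prems by auto
    have "(s \<otimes> t) \<otimes> a \<in> I"
      using I.I_l_closed[OF t(2) sc(1)] sc by (simp add: m_assoc)
    moreover have "(s \<otimes> t) \<otimes> f \<in> I" if "f \<in> F" for f
    proof -
      have "f \<in> carrier R" "s \<otimes> f \<in> I" using that s insert.prems by auto
      then show ?thesis using I.I_l_closed[of "s \<otimes> f" t] sc by (simp add: m_ac)
    qed
    ultimately have "(\<otimes>) (s \<otimes> t) ` insert a F \<subseteq> I" by blast
    then show ?case using S.m_closed s t by blast
  qed
  then show thesis using that by blast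
qed

lemma (in cring) minimal_prime_complement:
  assumes rad: "radical_ideal I" and max: "maximal_avoiding I S"
  shows "minimal_prime_over R I (carrier R - S)"
proof -
  interpret I: ideal I R using rad unfolding radical_ideal_def by simp
  interpret S: submonoid S R using max unfolding maximal_avoiding_def by simp
  have disj: "S \<inter> I = {}" using max unfolding maximal_avoiding_def by simp
  \<comment> \<open>Otherwise s a would lie in both \<open>S\<close> and \<open>I\<close>. Together
    with \<open>maximal_avoiding_mult\<close> this describes the complement of \<open>S\<close> as
    the set of all a with s a in \<open>I\<close> for some s in \<open>S\<close>, from which the
    ideal laws follow.\<close>
  have out: "a \<in> carrier R - S" if "s \<in> S" "a \<in> carrier R" "s \<otimes> a \<in> I" for s a
    using that disj S.m_closed by blast
  note avoid = maximal_avoiding_mult[OF rad max]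
  have "primeideal (carrier R - S) R"
  proof (intro primeidealI idealI is_cring ring_axioms)
    show "subgroup (carrier R - S) (add_monoid R)"
    proof (rule add.subgroupI)
      show "carrier R - S \<noteq> {}" using disj I.zero_closed zero_closed by blast
    next
      fix a assume "a \<in> carrier R - S"
      moreover then obtain s where "s \<in> S" "s \<otimes> a \<in> I" using avoid by blast
      ultimately show "\<ominus> a \<in> carrier R - S"
        using out[of s "\<ominus> a"] S.mem_carrier I.a_inv_closed by (simp add: r_minus)
    next
      fix a b assume ab: "a \<in> carrier R - S" "b \<in> carrier R - S"
      \<comment> \<open>Sums need one multiplier that works for both summands.\<close>
      then obtain s where s: "s \<in> S" "(\<otimes>) s ` {a, b} \<subseteq> I"
        using maximal_avoiding_mult_finite[OF rad max, of "{a, b}"] by blast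
      then have "s \<otimes> a \<oplus> s \<otimes> b \<in> I" using I.a_closed by blast
      then show "a \<oplus> b \<in> carrier R - S"
        using out[of s "a \<oplus> b"] s ab S.mem_carrier by (simp add: r_distr)
    qed simp
  next
    fix a x assume a: "a \<in> carrier R - S" and x: "x \<in> carrier R"
    then obtain s where s: "s \<in> S" "s \<otimes> a \<in> I" using avoid by blast
    have "s \<otimes> (a \<otimes> x) = (s \<otimes> a) \<otimes> x" using s a x S.mem_carrier by (simp add: m_assoc)
    then show ax: "a \<otimes> x \<in> carrier R - S"
      using out[of s "a \<otimes> x"] s a x I.I_r_closed by simp
    then show "x \<otimes> a \<in> carrier R - S" using a x by (simp add: m_comm)
  next
    show "carrier R \<noteq> carrier R - S" using S.one_closed by blast
  next
    fix a b assume "a \<in> carrier R" "b \<in> carrier R" "a \<otimes> b \<in> carrier R - S"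
    then show "a \<in> carrier R - S \<or> b \<in> carrier R - S" using S.m_closed by blast
  qed
  moreover have "I \<subseteq> carrier R - S" using disj I.a_subset by blast
  \<comment> \<open>Minimality of the prime is maximality of \<open>S\<close>: the complement of
    \<open>Q\<close> is a multiplicative set that avoids \<open>I\<close> and contains
    \<open>S\<close>.\<close>
  moreover have "Q = carrier R - S"
    if Q: "primeideal Q R" "I \<subseteq> Q" "Q \<subseteq> carrier R - S" for Q
  proof -
    have "submonoid (carrier R - Q) R" "(carrier R - Q) \<inter> I = {}" "S \<subseteq> carrier R - Q"
      using primeideal.submonoid_complement Q S.subset by blast+
    then have "carrier R - Q = S" using max unfolding maximal_avoiding_def by blast
    then show ?thesis using Q(3) by blast
  qed
  ultimately show ?thesis unfolding minimal_prime_over_def by blast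
qed

section \<open>Both kinds of H-ideals as closure with respect to a family of test sets\<close>

definition H_closed ::
    "('a, 'm) ring_scheme \<Rightarrow> 'a set set \<Rightarrow> 'a set set \<Rightarrow> 'a set \<Rightarrow> bool"
  where "H_closed R Y \<F> I \<longleftrightarrow> ideal I R \<and>
    (\<forall>F \<in> \<F>. \<forall>b \<in> carrier R. F \<subseteq> I \<and> h_sub Y F \<subseteq> h_sub Y {b} \<longrightarrow> b \<in> I)"

lemma H_ideal_eq_H_closed: "H_ideal R Y = H_closed R Y (range (\<lambda>a. {a}))"
  unfolding H_ideal_def H_closed_def by (intro ext) auto

lemma strong_H_ideal_eq_H_closed: "strong_H_ideal R Y = H_closed R Y {F. finite F}"
  unfolding strong_H_ideal_def H_closed_def by (intro ext) auto

text \<open>The test sets in \<open>\<F>\<close> will be the singletons for the weak notion and all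
  finite sets for the strong one. Finiteness yields a common multiplier, singletons yield
  radicality, and closure under images allows F to be replaced by a F.\<close>

locale H_family = cring R for R (structure) +
  fixes Y \<F> :: "'a set set"
  assumes Y_Spec: "Y \<subseteq> Spec R"
    and finite_family: "F \<in> \<F> \<Longrightarrow> finite F"
    and singleton_family: "{a} \<in> \<F>"
    and image_family: "F \<in> \<F> \<Longrightarrow> f ` F \<in> \<F>"
begin

text \<open>A prime of \<open>Y\<close> containing a F contains a or all of F. In the second case it
  contains b by assumption, so a b belongs to it either way.\<close>

lemma h_sub_mult:
  assumes "a \<in> carrier R" "b \<in> carrier R" "F \<subseteq> carrier R" "h_sub Y F \<subseteq> h_sub Y {b}"
  shows "h_sub Y ((\<otimes>) a ` F) \<subseteq> h_sub Y {a \<otimes> b}"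
proof
  fix P assume P: "P \<in> h_sub Y ((\<otimes>) a ` F)"
  then have "P \<in> Y" unfolding h_sub_def by simp
  then interpret P: primeideal P R using Y_Spec unfolding Spec_def by blast
  have "a \<otimes> b \<in> P"
  proof (cases "a \<in> P")
    case True
    then show ?thesis using assms(2) P.I_r_closed by simp
  next
    case False
    then have "F \<subseteq> P" using P P.I_prime assms(1,3) unfolding h_sub_def by blast
    then have "b \<in> P" using assms(4) \<open>P \<in> Y\<close> unfolding h_sub_def by blast
    then show ?thesis using assms(1) P.I_l_closed by simp
  qed
  then show "P \<in> h_sub Y {a \<otimes> b}" using \<open>P \<in> Y\<close> unfolding h_sub_def by simp
qed

lemma H_closed_mult:
  assumes "H_closed R Y \<F> I" "F \<in> \<F>" "F \<subseteq> carrier R" "a \<in> carrier R" "b \<in> carrier R"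
    and "(\<otimes>) a ` F \<subseteq> I" "h_sub Y F \<subseteq> h_sub Y {b}"
  shows "a \<otimes> b \<in> I"
proof -
  have "(\<otimes>) a ` F \<in> \<F>" using image_family assms(2) .
  moreover have "h_sub Y ((\<otimes>) a ` F) \<subseteq> h_sub Y {a \<otimes> b}"
    using h_sub_mult assms by simp
  moreover have "a \<otimes> b \<in> carrier R" using assms by simp
  ultimately show ?thesis using assms(1,6) unfolding H_closed_def by simp
qed

text \<open>Every prime of \<open>Y\<close> containing a power of a contains a, so the closure
  condition for the singleton test set {a^n} gives a.\<close>

lemma H_closed_radical:
  assumes "H_closed R Y \<F> I"
  shows "radical_ideal I"
proof -
  have "a \<in> I" if "a \<in> carrier R" "a [^] n \<in> I" for a and n :: nat
  proof -
    have "a \<in> P" if "P \<in> Y" "a [^] n \<in> P" for P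
    proof -
      have "primeideal P R" using that(1) Y_Spec unfolding Spec_def by blast
      then show ?thesis using primeideal.prime_powD that(2) \<open>a \<in> carrier R\<close> by metis
    qed
    then have "h_sub Y {a [^] n} \<subseteq> h_sub Y {a}" unfolding h_sub_def by simp blast
    moreover have "{a [^] n} \<in> \<F>" by (rule singleton_family)
    ultimately show ?thesis
      using assms that unfolding H_closed_def by simp
  qed
  then show ?thesis using assms unfolding radical_ideal_def H_closed_def by simp
qed

text \<open>For a test set F outside \<open>S\<close>, some s in \<open>S\<close> moves F into
  \<open>I\<close>. Then s b lies in \<open>I\<close>, which is impossible if b is in
  \<open>S\<close>, as s b would be in \<open>S\<close> as well.\<close>

lemma H_closed_complement:
  assumes I: "H_closed R Y \<F> I" and max: "maximal_avoiding I S"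
  shows "H_closed R Y \<F> (carrier R - S)"
proof -
  have rad: "radical_ideal I" using H_closed_radical I .
  interpret S: submonoid S R using max unfolding maximal_avoiding_def by simp
  have "ideal (carrier R - S) R"
    using minimal_prime_complement[OF rad max] primeideal.axioms(1)
    unfolding minimal_prime_over_def by blast
  moreover have "b \<notin> S"
    if F: "F \<in> \<F>" "F \<subseteq> carrier R - S" and b: "b \<in> carrier R" "h_sub Y F \<subseteq> h_sub Y {b}" for F b
  proof -
    obtain s where s: "s \<in> S" "(\<otimes>) s ` F \<subseteq> I"
      using maximal_avoiding_mult_finite[OF rad max finite_family] F by blast
    then have "s \<otimes> b \<in> I" using H_closed_mult[OF I] F b S.mem_carrier by blast
    then show ?thesis using s S.m_closed max unfolding maximal_avoiding_def by blast
  qed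
  ultimately show ?thesis unfolding H_closed_def by blast
qed

text \<open>Forwards, all minimal primes over \<open>I\<close> of the given kind are taken; an x
  outside \<open>I\<close> is missed by the complement of a maximal avoiding set through x. For
  \<open>I\<close> the whole ring this family is empty. Backwards, the closure condition passes to
  intersections.\<close>

lemma H_closed_iff_Inter:
  assumes "ideal I R"
  shows "H_closed R Y \<F> I \<longleftrightarrow>
    (\<exists>\<P>. (\<forall>P \<in> \<P>. minimal_prime_over R I P \<and> H_closed R Y \<F> P) \<and> I = ideal_Inter R \<P>)"
proof
  assume I: "H_closed R Y \<F> I"
  have rad: "radical_ideal I" using H_closed_radical I .
  let ?P = "{P. minimal_prime_over R I P \<and> H_closed R Y \<F> P}"
  have "x \<in> I" if "x \<in> ideal_Inter R ?P" for x
  proof (rule ccontr)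
    assume "x \<notin> I"
    moreover have "x \<in> carrier R" using that unfolding ideal_Inter_def by simp
    ultimately obtain S where S: "maximal_avoiding I S" "x \<in> S"
      using ex_maximal_avoiding[OF rad] by blast
    then have "carrier R - S \<in> ?P"
      using minimal_prime_complement[OF rad] H_closed_complement[OF I] by blast
    then show False using that S unfolding ideal_Inter_def by blast
  qed
  moreover have "I \<subseteq> ideal_Inter R ?P"
    using additive_subgroup.a_subset[OF ideal.axioms(1)[OF assms]]
    unfolding ideal_Inter_def minimal_prime_over_def by blast
  ultimately have "I = ideal_Inter R ?P" by blast
  then show "\<exists>\<P>. (\<forall>P \<in> \<P>. minimal_prime_over R I P \<and> H_closed R Y \<F> P) \<and> I = ideal_Inter R \<P>"
    by (intro exI[of _ ?P]) simp
next
  assume "\<exists>\<P>. (\<forall>P \<in> \<P>. minimal_prime_over R I P \<and> H_closed R Y \<F> P) \<and> I = ideal_Inter R \<P>"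
  then show "H_closed R Y \<F> I"
    using assms unfolding H_closed_def ideal_Inter_def by blast
qed

section \<open>Colon ideals and maximal proper H-ideals\<close>

lemma H_closed_colon:
  assumes M: "H_closed R Y \<F> M" and a: "a \<in> carrier R"
  shows "H_closed R Y \<F> {x \<in> carrier R. a \<otimes> x \<in> M}" (is "H_closed R Y \<F> ?J")
proof -
  interpret M: ideal M R using M unfolding H_closed_def by simp
  have "ideal ?J R"
  proof (rule idealI[OF ring_axioms])
    show "subgroup ?J (add_monoid R)"
    proof (rule add.subgroupI)
      have "\<zero> \<in> ?J" using a M.zero_closed by simp
      then show "?J \<noteq> {}" by blast
    qed (use a M.a_closed M.a_inv_closed in \<open>auto simp: r_minus r_distr\<close>)
  next
    fix x y assume x: "x \<in> ?J" and y: "y \<in> carrier R"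
    then have "(a \<otimes> x) \<otimes> y \<in> M" by (simp add: M.I_r_closed)
    then show xy: "x \<otimes> y \<in> ?J" using a x y by (simp add: m_assoc)
    then show "y \<otimes> x \<in> ?J" using x y by (simp add: m_comm)
  qed
  \<comment> \<open>F inside \<open>?J\<close> puts a F inside \<open>M\<close>, and
    \<open>H_closed_mult\<close> then puts a b there.\<close>
  moreover have "b \<in> ?J"
    if "F \<in> \<F>" "F \<subseteq> ?J" "b \<in> carrier R" "h_sub Y F \<subseteq> h_sub Y {b}" for F b
    using H_closed_mult[OF M \<open>F \<in> \<F>\<close> _ a, of b] that by blast
  ultimately show ?thesis unfolding H_closed_def by blast
qed

lemma maximal_H_closed_prime:
  assumes "maximal_among_proper R (H_closed R Y \<F>) M"
  shows "primeideal M R"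
proof -
  have M: "H_closed R Y \<F> M" "M \<noteq> carrier R"
    and max: "\<And>J. H_closed R Y \<F> J \<Longrightarrow> J \<noteq> carrier R \<Longrightarrow> M \<subseteq> J \<Longrightarrow> J = M"
    using assms unfolding maximal_among_proper_def by blast+
  interpret M: ideal M R using M unfolding H_closed_def by simp
  show ?thesis
  proof (intro primeidealI M.ideal_axioms is_cring)
    fix a b assume ab: "a \<in> carrier R" "b \<in> carrier R" "a \<otimes> b \<in> M"
    let ?J = "{x \<in> carrier R. a \<otimes> x \<in> M}"
    have "b \<in> M" if "a \<notin> M"
    proof -
      \<comment> \<open>The choice of a outside \<open>M\<close> makes the colon ideal proper, so
        maximality forces it to be \<open>M\<close>; it contains b because a b is in
        \<open>M\<close>.\<close>
      have "\<one> \<notin> ?J" using that ab by simp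
      then have "?J \<noteq> carrier R" using one_closed by blast
      moreover have "M \<subseteq> ?J" using ab M.a_subset M.I_l_closed by blast
      ultimately have "?J = M" using max H_closed_colon[OF M(1) ab(1)] by blast
      then show ?thesis using ab by blast
    qed
    then show "a \<in> M \<or> b \<in> M" by blast
  qed (use M in blast)
qed

end

theorem corollary3p14:
  fixes R :: "('a, 'm) ring_scheme" and Y :: "'a set set"
  assumes "cring R" and "Y \<subseteq> Spec R"
  shows
    "(\<forall>I. ideal I R \<longrightarrow>
        (H_ideal R Y I \<longleftrightarrow>
          (\<exists>\<P>. (\<forall>P \<in> \<P>. minimal_prime_over R I P \<and> H_ideal R Y P) \<and> I = ideal_Inter R \<P>)) \<and>
        (strong_H_ideal R Y I \<longleftrightarrow>
          (\<exists>\<P>. (\<forall>P \<in> \<P>. minimal_prime_over R I P \<and> strong_H_ideal R Y P) \<and> I = ideal_Inter R \<P>))) \<and>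
     (\<forall>M. maximal_among_proper R (H_ideal R Y) M \<longrightarrow> primeideal M R \<and> H_ideal R Y M) \<and>
     (\<forall>M. maximal_among_proper R (strong_H_ideal R Y) M \<longrightarrow> primeideal M R \<and> strong_H_ideal R Y M)"
proof -
  \<comment> \<open>Images of singletons are singletons and images of finite sets are finite, so
    both families qualify.\<close>
  have weak: "H_family R Y (range (\<lambda>a. {a}))"
    using assms by (intro H_family.intro H_family_axioms.intro) auto
  have strong: "H_family R Y {F. finite F}"
    using assms by (intro H_family.intro H_family_axioms.intro) auto
  show ?thesis
    unfolding H_ideal_eq_H_closed strong_H_ideal_eq_H_closed
    using H_family.H_closed_iff_Inter[OF weak] H_family.H_closed_iff_Inter[OF strong]
      H_family.maximal_H_closed_prime[OF weak] H_family.maximal_H_closed_prime[OF strong]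
    by (auto simp: maximal_among_proper_def)
qed

end
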